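(* Let $s_1,\dots,s_n$ ($n\ge2$) be sites which are all neighbors of each other, let $(X_{s_1},\dots,X_{s_n})$ have joint pmf $\Pi_{s_1,\dots,s_n}$, and suppose $\hat\pi_{s_i}(\cdot)\equiv\pi_{s_i}(\cdot)$ for $1\le i\le n$. If for some $1\le i\le n$, $X_{s_i}$ is uncorrelated with each of the remaining $X_{s_j}$ ($1\le j\le n$, $j\ne i$), then $X_{s_i}$ is independent of the collection $\{X_{s_j}:1\le j\le n,\ j\neq i\}$.
   Context: $(S,\partial)$ is a connected finite space of sites with a neighborhood system $\partial$ ($s\notin\partial(s)$; $s\in\partial(t)$ iff $t\in\partial(s)$; $t$ is a neighbor of $s$ if $t\in\partial(s)$). For each $s_i$, $\mathbf{X}_{s_i}$ is a finite set of reals; $\pi_{s_i}$ is a strictly positive pmf on $\mathbf{X}_{s_i}$, and $\tilde\pi_{s_i},\hat\pi_{s_i}$ are two auxiliary pmfs on $\mathbf{X}_{s_i}$; $\mu_{\tilde\pi_{s_i}}$ and $\sigma^2_{\tilde\pi_{s_i}}>0$ are the mean and variance of $\tilde\pi_{s_i}$. $\beta_{s_i,s_j}=\beta_{s_j,s_i}$ ($i\neq j$) are real numbers, the prescribed covariances: $\mathrm{cov}(X_{s_i},X_{s_j})=\beta_{s_i,s_j}$ holds under the joint pmf below, and $X_{s_i},X_{s_j}$ are uncorrelated when this is $0$. The joint pmf $\Pi_{s_1,\dots,s_n}$ of the field generated sequentially in the order $s_1,\dots,s_n$ is defined by $\Pi_{s_1}=\pi_{s_1}$ and, for $2\le i\le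 n$, $$\Pi_{s_1,\dots,s_i}(x_{s_1},\dots,x_{s_i})=\Pi_{s_1,\dots,s_{i-1}}(x_{s_1},\dots,x_{s_{i-1}})\,\pi_{s_i}(x_{s_i})+\frac{\tilde\pi_{s_i}(x_{s_i})(x_{s_i}-\mu_{\tilde\pi_{s_i}})}{\sigma^2_{\tilde\pi_{s_i}}}\sum_{j=1}^{i-1}\ \prod_{k=1,k\ne j}^{i-1}\hat\pi_{s_k}(x_{s_k})\cdot\frac{\beta_{s_i,s_j}\tilde\pi_{s_j}(x_{s_j})(x_{s_j}-\mu_{\tilde\pi_{s_j}})}{\sigma^2_{\tilde\pi_{s_j}}};$$ these functions, and those obtained in the same way from any reordering of the sites, are assumed to be pmfs (regularity). *)

theory Defs
  imports "HOL-Probability.Probability"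
begin

definition site_space :: "'s set \<Rightarrow> ('s \<Rightarrow> 's set) \<Rightarrow> bool" where
  "site_space S nb \<longleftrightarrow>
     finite S \<and> (\<forall>s\<in>S. nb s \<subseteq> S \<and> s \<notin> nb s) \<and> (\<forall>s\<in>S. \<forall>t\<in>S. s \<in> nb t \<longleftrightarrow> t \<in> nb s)"

definition connected_site_space :: "'s set \<Rightarrow> ('s \<Rightarrow> 's set) \<Rightarrow> bool" where
  "connected_site_space S nb \<longleftrightarrow>
     site_space S nb \<and> (\<forall>s\<in>S. \<forall>t\<in>S. (s, t) \<in> {(u, v). u \<in> S \<and> v \<in> nb u}\<^sup>*)"

abbreviation pmf_mean :: "real pmf \<Rightarrow> real" where
  "pmf_mean p \<equiv> measure_pmf.expectation p (\<lambda>x. x)"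

abbreviation pmf_variance :: "real pmf \<Rightarrow> real" where
  "pmf_variance p \<equiv> measure_pmf.variance p (\<lambda>x. x)"

definition dev_factor :: "real pmf \<Rightarrow> real \<Rightarrow> real" where
  "dev_factor p x = pmf p x * (x - pmf_mean p) / pmf_variance p"

(* field_pmf \<pi> \<pi>t \<pi>h \<beta> s i is the function generated in the order s 1, ..., s i
   (sites are numbered from 1; the value at i = 0 is a dummy). \<pi>t and \<pi>h are the
   auxiliary pmfs written with a tilde and with a hat. A configuration x assigns a
   value to each site, so that its arguments do not depend on the generation order. *)
fun field_pmf ::
  "('s \<Rightarrow> real pmf) \<Rightarrow> ('s \<Rightarrow> real pmf) \<Rightarrow> ('s \<Rightarrow> real pmf) \<Rightarrow> ('s \<Rightarrow> 's \<Rightarrow> real)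
    \<Rightarrow> (nat \<Rightarrow> 's) \<Rightarrow> nat \<Rightarrow> ('s \<Rightarrow> real) \<Rightarrow> real" where
  "field_pmf \<pi> \<pi>t \<pi>h \<beta> s 0 x = 1"
| "field_pmf \<pi> \<pi>t \<pi>h \<beta> s (Suc 0) x = pmf (\<pi> (s 1)) (x (s 1))"
| "field_pmf \<pi> \<pi>t \<pi>h \<beta> s (Suc (Suc m)) x =
     (let i = Suc (Suc m) in
       field_pmf \<pi> \<pi>t \<pi>h \<beta> s (i - 1) x * pmf (\<pi> (s i)) (x (s i))
       + dev_factor (\<pi>t (s i)) (x (s i)) *
         (\<Sum>j\<in>{1..i - 1}. (\<Prod>k\<in>{1..i - 1} - {j}. pmf (\<pi>h (s k)) (x (s k)))
            * (\<beta> (s i) (s j) * dev_factor (\<pi>t (s j)) (x (s j)))))"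

definition is_joint_pmf :: "'s set \<Rightarrow> ('s \<Rightarrow> real set) \<Rightarrow> (('s \<Rightarrow> real) \<Rightarrow> real) \<Rightarrow> bool" where
  "is_joint_pmf A E f \<longleftrightarrow> (\<forall>x\<in>PiE A E. 0 \<le> f x) \<and> (\<Sum>x\<in>PiE A E. f x) = 1"

definition field_regular ::
  "('s \<Rightarrow> real set) \<Rightarrow> ('s \<Rightarrow> real pmf) \<Rightarrow> ('s \<Rightarrow> real pmf) \<Rightarrow> ('s \<Rightarrow> real pmf)
    \<Rightarrow> ('s \<Rightarrow> 's \<Rightarrow> real) \<Rightarrow> (nat \<Rightarrow> 's) \<Rightarrow> nat \<Rightarrow> bool" where
  "field_regular E \<pi> \<pi>t \<pi>h \<beta> s n \<longleftrightarrow>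
     (\<forall>p. p permutes {1..n} \<longrightarrow>
       (\<forall>i\<in>{1..n}. is_joint_pmf ((s \<circ> p) ` {1..i}) E (field_pmf \<pi> \<pi>t \<pi>h \<beta> (s \<circ> p) i)))"

definition covariance :: "'a measure \<Rightarrow> ('a \<Rightarrow> real) \<Rightarrow> ('a \<Rightarrow> real) \<Rightarrow> real" where
  "covariance M X Y =
     integral\<^sup>L M (\<lambda>\<omega>. (X \<omega> - integral\<^sup>L M X) * (Y \<omega> - integral\<^sup>L M Y))"

definition uncorrelated :: "'a measure \<Rightarrow> ('a \<Rightarrow> real) \<Rightarrow> ('a \<Rightarrow> real) \<Rightarrow> bool" where
  "uncorrelated M X Y \<longleftrightarrow> covariance M X Y = 0"

(* The indep_var of the library forces both random variables to take values in the same
   type. This is its heterogeneous version; compare indep_var_eq. *)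
definition indep_rv ::
  "'a measure \<Rightarrow> 'b measure \<Rightarrow> ('a \<Rightarrow> 'b) \<Rightarrow> 'c measure \<Rightarrow> ('a \<Rightarrow> 'c) \<Rightarrow> bool" where
  "indep_rv M N X N' Y \<longleftrightarrow>
     X \<in> measurable M N \<and> Y \<in> measurable M N' \<and>
     prob_space.indep_set M {X -` A \<inter> space M | A. A \<in> sets N}
                            {Y -` A \<inter> space M | A. A \<in> sets N'}"

end

theory Submission
  imports Defs
begin

text \<open>
  Unrolling the recursion with \<open>\<pi>h = \<pi>\<close> writes the density as the product of the \<open>\<pi> (s l)\<close>
  plus, for each pair \<open>j < k\<close>, the term \<open>\<beta> (s k) (s j)\<close> times the same product with
  \<open>dev_factor (\<pi>t (s l))\<close> in place of \<open>\<pi> (s l)\<close> for \<open>l \<in> {j, k}\<close>. A deviation factor has total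
  sum 0 and sum 1 against a centered variable, so each covariance equals its coefficient. If \<open>s i\<close>
  is uncorrelated with the other sites, all terms whose pair contains \<open>i\<close> vanish, and
  \<open>\<pi> (s i)\<close> splits off as a factor of the density.
\<close>


section \<open>Sums over finite product spaces and discrete joint densities\<close>

lemma sum_PiE_prod_reindex:
  fixes g :: "'i \<Rightarrow> 'b \<Rightarrow> 'c::comm_semiring_1"
  assumes I: "finite I" and s: "inj_on s I" and E: "\<And>k. k \<in> I \<Longrightarrow> finite (E (s k))"
  shows "(\<Sum>x\<in>PiE (s ` I) E. \<Prod>k\<in>I. g k (x (s k))) = (\<Prod>k\<in>I. \<Sum>y\<in>E (s k). g k y)"
proof -
  \<comment> \<open>The factors are indexed by positions, the configurations by sites; injectivity
    of \<open>s\<close> allows \<open>inv_into\<close> to recover the position, after which sum and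
    product can be exchanged.\<close>
  have "(\<Sum>x\<in>PiE (s ` I) E. \<Prod>k\<in>I. g k (x (s k)))
      = (\<Sum>x\<in>PiE (s ` I) E. \<Prod>t\<in>s ` I. g (inv_into I s t) (x t))"
    using s by (intro sum.cong refl) (simp add: prod.reindex)
  also have "\<dots> = (\<Prod>t\<in>s ` I. \<Sum>y\<in>E t. g (inv_into I s t) y)"
    using I E by (intro prod_sum_PiE[symmetric]) auto
  also have "\<dots> = (\<Prod>k\<in>I. \<Sum>y\<in>E (s k). g k y)"
    using s by (simp add: prod.reindex)
  finally show ?thesis .
qed

lemma integral_distributed_count_space:
  fixes f h :: "'b \<Rightarrow> real"
  assumes C: "finite C" and Z: "distributed M (count_space C) Z (\<lambda>x. ennreal (f x))"
    and f: "\<And>x. x \<in> C \<Longrightarrow> 0 \<le> f x"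
  shows "(\<integral>\<omega>. h (Z \<omega>) \<partial>M) = (\<Sum>x\<in>C. f x * h x)"
  using distributed_integral[OF Z, of h] C f
  by (simp add: lebesgue_integral_count_space_finite)

lemma measure_distributed_count_space:
  fixes f :: "'b \<Rightarrow> real"
  assumes C: "finite C" and Z: "distributed M (count_space C) Z (\<lambda>x. ennreal (f x))"
    and f: "\<And>x. x \<in> C \<Longrightarrow> 0 \<le> f x"
  shows "measure M {\<omega> \<in> space M. Q (Z \<omega>)} = (\<Sum>x | x \<in> C \<and> Q x. f x)"
proof -
  have m: "Z \<in> measurable M (count_space C)"
    using Z by (simp add: distributed_def)
  have "measure M {\<omega> \<in> space M. Q (Z \<omega>)} = (\<integral>\<omega>. indicator {\<omega> \<in> space M. Q (Z \<omega>)} \<omega> \<partial>M)"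
    by (simp add: Int_absorb2)
  also have "\<dots> = (\<integral>\<omega>. of_bool (Q (Z \<omega>)) \<partial>M)"
    by (intro Bochner_Integration.integral_cong) (auto simp: indicator_def)
  also have "\<dots> = (\<Sum>x\<in>C. f x * of_bool (Q x))"
    using integral_distributed_count_space[OF C Z f] by simp
  also have "\<dots> = (\<Sum>x | x \<in> C \<and> Q x. f x)"
    using C by (simp add: Int_def)
  finally show ?thesis .
qed

text \<open>A configuration on \<open>insert a T\<close> is the same as a value at \<open>a\<close>
  together with a configuration on \<open>T\<close>; since \<open>a\<close> is outside
  \<open>T\<close>, the map \<open>v(a := u)\<close> inverts this splitting, and the sum becomes one
  over a rectangle.\<close>

lemma sum_PiE_insert_product:
  fixes g :: "'b \<Rightarrow> real" and h :: "('s \<Rightarrow> 'b) \<Rightarrow> real"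
  assumes a: "a \<notin> T" 
  shows "(\<Sum>x | x \<in> PiE (insert a T) E \<and> P (x a) \<and> Q (restrict x T). g (x a) * h (restrict x T))
       = (\<Sum>u | u \<in> E a \<and> P u. g u) * (\<Sum>v | v \<in> PiE T E \<and> Q v. h v)"
proof -
  have r: "restrict (v(a := u)) T = v" if "v \<in> PiE T E" for u v
    using that a by (auto simp: restrict_def PiE_def extensional_def fun_eq_iff)
  have u: "(restrict x T)(a := x a) = x" if "x \<in> PiE (insert a T) E" for x
    using that by (auto simp: restrict_def PiE_def extensional_def fun_eq_iff)
  have "(\<Sum>x | x \<in> PiE (insert a T) E \<and> P (x a) \<and> Q (restrict x T). g (x a) * h (restrict x T))
      = (\<Sum>(u, v) \<in> {u \<in> E a. P u} \<times> {v \<in> PiE T E. Q v}. g u * h v)"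
    by (rule sum.reindex_bij_witness[where j = "\<lambda>x. (x a, restrict x T)"
          and i = "\<lambda>(u, v). v(a := u)"])
       (auto simp: r u PiE_mem dest: PiE_arb split: if_splits)
  then show ?thesis
    by (simp add: sum_product sum.cartesian_product)
qed

text \<open>Independence follows from a factorized joint density even when neither \<open>g\<close>
  nor \<open>h\<close> is normalized: every joint event has as probability a product of a
  \<open>g\<close>-sum and an \<open>h\<close>-sum, and the two total sums multiply to 1.\<close>

lemma indep_rv_product_density:
  fixes X :: "'s \<Rightarrow> 'a \<Rightarrow> real" and g :: "real \<Rightarrow> real" and h :: "('s \<Rightarrow> real) \<Rightarrow> real"
  assumes M: "prob_space M" and a: "a \<notin> T" and T: "finite T"
    and E: "\<And>t. t \<in> insert a T \<Longrightarrow> finite (E t)"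
    and Z: "distributed M (count_space (PiE (insert a T) E)) (\<lambda>\<omega>. \<lambda>t\<in>insert a T. X t \<omega>)
              (\<lambda>x. ennreal (f x))"
    and f: "\<And>x. x \<in> PiE (insert a T) E \<Longrightarrow> 0 \<le> f x"
    and fgh: "\<And>x. x \<in> PiE (insert a T) E \<Longrightarrow> f x = g (x a) * h (restrict x T)"
  shows "indep_rv M borel (X a) (PiM T (\<lambda>_. borel)) (\<lambda>\<omega>. \<lambda>t\<in>T. X t \<omega>)"
proof -
  interpret prob_space M by (rule M)
  let ?C = "PiE (insert a T) E" and ?Z = "\<lambda>\<omega>. \<lambda>t\<in>insert a T. X t \<omega>"
  let ?Y = "\<lambda>\<omega>. \<lambda>t\<in>T. X t \<omega>"
  have C: "finite ?C" using T E by (intro finite_PiE) auto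
  have mZ: "?Z \<in> measurable M (count_space ?C)"
    using Z by (simp add: distributed_def)
  \<comment> \<open>Measurability of the single variables is inherited from the joint vector,
    because every function on a \<open>count_space\<close> is measurable.\<close>
  have mX: "X t \<in> borel_measurable M" if "t \<in> insert a T" for t
  proof -
    have "(\<lambda>\<omega>. ?Z \<omega> t) \<in> borel_measurable M"
      by (rule measurable_compose[OF mZ]) simp
    with that show ?thesis by auto
  qed
  have mY: "?Y \<in> measurable M (PiM T (\<lambda>_. borel))"
    using mX by (intro measurable_restrict) auto
  have P: "prob {\<omega> \<in> space M. P (X a \<omega>) \<and> Q (?Y \<omega>)}
      = (\<Sum>u | u \<in> E a \<and> P u. g u) * (\<Sum>v | v \<in> PiE T E \<and> Q v. h v)" for P Q
  proof -
    have r: "restrict (?Z \<omega>) T = ?Y \<omega>" for \<omega>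
      by (auto simp: restrict_def)
    have "prob {\<omega> \<in> space M. P (X a \<omega>) \<and> Q (?Y \<omega>)}
        = prob {\<omega> \<in> space M. P (?Z \<omega> a) \<and> Q (restrict (?Z \<omega>) T)}"
      unfolding r by simp
    also have "\<dots> = (\<Sum>x | x \<in> ?C \<and> P (x a) \<and> Q (restrict x T). f x)"
      by (rule measure_distributed_count_space[OF C Z f])
    also have "\<dots> = (\<Sum>x | x \<in> ?C \<and> P (x a) \<and> Q (restrict x T). g (x a) * h (restrict x T))"
      by (intro sum.cong) (auto simp: fgh)
    finally show ?thesis
      by (simp only: sum_PiE_insert_product[OF a])
  qed
  have one: "(\<Sum>u | u \<in> E a \<and> True. g u) * (\<Sum>v | v \<in> PiE T E \<and> True. h v) = 1"
    using P[of "\<lambda>_. True" "\<lambda>_. True"] prob_space by simp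
  have indep: "prob ({\<omega> \<in> space M. P (X a \<omega>)} \<inter> {\<omega> \<in> space M. Q (?Y \<omega>)})
      = prob {\<omega> \<in> space M. P (X a \<omega>)} * prob {\<omega> \<in> space M. Q (?Y \<omega>)}" for P Q
  proof -
    have "{\<omega> \<in> space M. P (X a \<omega>)} \<inter> {\<omega> \<in> space M. Q (?Y \<omega>)}
        = {\<omega> \<in> space M. P (X a \<omega>) \<and> Q (?Y \<omega>)}" by auto
    \<comment> \<open>In the product of the two marginal probabilities the total
      \<open>g\<close>-sum and the total \<open>h\<close>-sum occur once each, and
      \<open>one\<close> cancels them together.\<close>
    then show ?thesis
      using P[of P Q] P[of P "\<lambda>_. True"] P[of "\<lambda>_. True" Q] one
      by (simp add: mult_ac)
  qed
  have v: "W -` A \<inter> space M = {\<omega> \<in> space M. W \<omega> \<in> A}" for W :: "'a \<Rightarrow> 'd" and A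
    by auto
  show ?thesis
    unfolding indep_rv_def
  proof (intro conjI indep_setI)
    show "X a \<in> borel_measurable M" using mX by simp
    show "{X a -` A \<inter> space M |A. A \<in> sets borel} \<subseteq> events"
      using mX by (auto intro: measurable_sets)
    show "{?Y -` A \<inter> space M |A. A \<in> sets (PiM T (\<lambda>_. borel))} \<subseteq> events"
      using mY by (auto intro: measurable_sets)
    fix A B
    assume "A \<in> {X a -` A \<inter> space M |A. A \<in> sets borel}"
      and "B \<in> {?Y -` A \<inter> space M |A. A \<in> sets (PiM T (\<lambda>_. borel))}"
    then obtain A' B' where "A = {\<omega> \<in> space M. X a \<omega> \<in> A'}" "B = {\<omega> \<in> space M. ?Y \<omega> \<in> B'}"
      unfolding v by blast
    then show "prob (A \<inter> B) = prob A * prob B"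
      using indep by simp
  qed (rule mY)
qed

section \<open>Zeroth and first moments of a deviation factor\<close>

lemma sum_pmf_mult:
  fixes p :: "real pmf" and f :: "real \<Rightarrow> real"
  assumes "finite A" "set_pmf p \<subseteq> A"
  shows "(\<Sum>y\<in>A. pmf p y * f y) = measure_pmf.expectation p f"
  using assms by (subst integral_measure_pmf_real[of A]) (auto simp: mult.commute)

lemma sum_pmf_centered:
  assumes "finite A" "set_pmf p \<subseteq> A"
  shows "(\<Sum>y\<in>A. pmf p y * (y - pmf_mean p)) = 0"
  using assms sum_pmf_mult[OF assms, of "\<lambda>y. y"] sum_pmf_eq_1[OF assms]
  by (simp add: right_diff_distrib sum_subtractf flip: sum_distrib_right)

lemma sum_dev_factor:
  assumes "finite A" "set_pmf p \<subseteq> A"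
  shows "(\<Sum>y\<in>A. dev_factor p y) = 0"
  using sum_pmf_centered[OF assms] by (simp add: dev_factor_def flip: sum_divide_distrib)

text \<open>The center \<open>c\<close> may be arbitrary because deviation factors sum to 0; around
  its own mean, the sum is the variance divided by itself. The freedom matters: the field is
  centered at the means of \<open>\<pi>\<close>, while the deviation factors come from
  \<open>\<pi>t\<close>.\<close>

lemma sum_dev_factor_centered:
  assumes "finite A" "set_pmf p \<subseteq> A" "pmf_variance p > 0"
  shows "(\<Sum>y\<in>A. dev_factor p y * (y - c)) = 1"
proof -
  have "(\<Sum>y\<in>A. dev_factor p y * (y - c))
      = (\<Sum>y\<in>A. dev_factor p y * (y - pmf_mean p) + (pmf_mean p - c) * dev_factor p y)"
    by (intro sum.cong refl) (simp add: algebra_simps)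
  also have "\<dots> = (\<Sum>y\<in>A. dev_factor p y * (y - pmf_mean p))"
    using sum_dev_factor[OF assms(1,2)] by (simp add: sum.distrib flip: sum_distrib_left)
  also have "\<dots> = (\<Sum>y\<in>A. pmf p y * (y - pmf_mean p)\<^sup>2) / pmf_variance p"
    by (simp add: dev_factor_def sum_divide_distrib power2_eq_square mult.assoc)
  also have "\<dots> = 1"
    using sum_pmf_mult[OF assms(1,2), of "\<lambda>y. (y - pmf_mean p)\<^sup>2"] assms(3) by simp
  finally show ?thesis .
qed

section \<open>Closed form of the recursively defined density\<close>

definition site_factor ::
  "('s \<Rightarrow> real pmf) \<Rightarrow> ('s \<Rightarrow> real pmf) \<Rightarrow> (nat \<Rightarrow> 's) \<Rightarrow> nat set \<Rightarrow> nat \<Rightarrow> real \<Rightarrow> real" where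
  "site_factor \<pi> \<pi>t s J l y = (if l \<in> J then dev_factor (\<pi>t (s l)) y else pmf (\<pi> (s l)) y)"

text \<open>Each recursion step multiplies all earlier terms by the new site's \<open>\<pi>\<close>
  and adds one term for each pair of the new site with an earlier one. As \<open>\<pi>h\<close>
  agrees with \<open>\<pi>\<close>, all terms have one shape: \<open>J\<close> collects the
  positions that carry a deviation factor, and is empty or a pair.\<close>

lemma field_pmf_expansion:
  assumes "\<And>k. k \<in> {1..n} \<Longrightarrow> \<pi>h (s k) = \<pi> (s k)"
  shows "field_pmf \<pi> \<pi>t \<pi>h \<beta> s n x
       = (\<Prod>l\<in>{1..n}. site_factor \<pi> \<pi>t s {} l (x (s l)))
         + (\<Sum>k\<in>{1..n}. \<Sum>j\<in>{1..<k}. \<beta> (s k) (s j)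
              * (\<Prod>l\<in>{1..n}. site_factor \<pi> \<pi>t s {j, k} l (x (s l))))"
  using assms
proof (induction \<pi> \<pi>t \<pi>h \<beta> s n x rule: field_pmf.induct)
  \<comment> \<open>The dummy value 1 matches the empty product, and there are no pairs.\<close>
  case (1 \<pi> \<pi>t \<pi>h \<beta> s x)
  then show ?case by simp
next
  case (2 \<pi> \<pi>t \<pi>h \<beta> s x)
  then show ?case by (simp add: site_factor_def)
next
  case (3 \<pi> \<pi>t \<pi>h \<beta> s m x)
  define i where "i = Suc (Suc m)"
  let ?F = "\<lambda>J l. site_factor \<pi> \<pi>t s J l (x (s l))"
  have i: "{1..i} = insert i {1..Suc m}" "{1..<i} = {1..Suc m}" "i - 1 = Suc m" "i \<notin> {1..Suc m}"
    by (auto simp: i_def)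
  have IH: "field_pmf \<pi> \<pi>t \<pi>h \<beta> s (Suc m) x
       = (\<Prod>l\<in>{1..Suc m}. ?F {} l)
         + (\<Sum>k\<in>{1..Suc m}. \<Sum>j\<in>{1..<k}. \<beta> (s k) (s j) * (\<Prod>l\<in>{1..Suc m}. ?F {j, k} l))"
    using "3.IH"[OF refl] "3.prems" by simp
  \<comment> \<open>Both members of an old pair lie below \<open>i\<close>, so the new site
    contributes its ordinary \<open>\<pi>\<close> factor.\<close>
  have old: "(\<Prod>l\<in>{1..i}. ?F {j, k} l) = (\<Prod>l\<in>{1..Suc m}. ?F {j, k} l) * pmf (\<pi> (s i)) (x (s i))"
    if "k \<in> {1..Suc m}" "j \<in> {1..<k}" for j k
    using that unfolding i(1) by (simp add: site_factor_def i_def)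
  \<comment> \<open>The pairs with \<open>i\<close> give the correction term of the recursion: two
    deviation factors, and \<open>\<pi>h\<close> in place of \<open>\<pi>\<close> at all other
    positions.\<close>
  have new: "(\<Prod>l\<in>{1..i}. ?F {j, i} l) = dev_factor (\<pi>t (s i)) (x (s i)) *
      ((\<Prod>k\<in>{1..Suc m} - {j}. pmf (\<pi>h (s k)) (x (s k))) * dev_factor (\<pi>t (s j)) (x (s j)))"
    if j: "j \<in> {1..Suc m}" for j
  proof -
    have "(\<Prod>l\<in>{1..Suc m} - {j}. ?F {j, i} l) = (\<Prod>k\<in>{1..Suc m} - {j}. pmf (\<pi>h (s k)) (x (s k)))"
      using "3.prems" i(4) by (intro prod.cong refl) (auto simp: site_factor_def i_def)
    moreover have "(\<Prod>l\<in>{1..Suc m}. ?F {j, i} l) = ?F {j, i} j * (\<Prod>l\<in>{1..Suc m} - {j}. ?F {j, i} l)"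
      using j by (intro prod.remove) auto
    moreover have "(\<Prod>l\<in>{1..i}. ?F {j, i} l) = ?F {j, i} i * (\<Prod>l\<in>{1..Suc m}. ?F {j, i} l)"
      unfolding i(1) using i(4) by (intro prod.insert) auto
    ultimately show ?thesis
      by (simp add: site_factor_def mult_ac)
  qed
  have p: "(\<Prod>l\<in>{1..i}. ?F {} l) = pmf (\<pi> (s i)) (x (s i)) * (\<Prod>l\<in>{1..Suc m}. ?F {} l)"
    unfolding i(1) using i(4) by (subst prod.insert) (auto simp: site_factor_def)
  have sum_i: "(\<Sum>k\<in>{1..i}. g k) = g i + (\<Sum>k\<in>{1..Suc m}. g k)" for g :: "nat \<Rightarrow> real"
    unfolding i(1) using i(4) by (intro sum.insert) auto
  have "(\<Sum>k\<in>{1..i}. \<Sum>j\<in>{1..<k}. \<beta> (s k) (s j) * (\<Prod>l\<in>{1..i}. ?F {j, k} l))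
      = (\<Sum>j\<in>{1..Suc m}. \<beta> (s i) (s j) * (\<Prod>l\<in>{1..i}. ?F {j, i} l))
        + (\<Sum>k\<in>{1..Suc m}. \<Sum>j\<in>{1..<k}. \<beta> (s k) (s j) * (\<Prod>l\<in>{1..i}. ?F {j, k} l))"
    (is "?L = _")
    unfolding sum_i i(2) ..
  also have "\<dots> = dev_factor (\<pi>t (s i)) (x (s i)) *
         (\<Sum>j\<in>{1..Suc m}. (\<Prod>k\<in>{1..Suc m} - {j}. pmf (\<pi>h (s k)) (x (s k)))
            * (\<beta> (s i) (s j) * dev_factor (\<pi>t (s j)) (x (s j))))
        + (\<Sum>k\<in>{1..Suc m}. \<Sum>j\<in>{1..<k}. \<beta> (s k) (s j) * (\<Prod>l\<in>{1..Suc m}. ?F {j, k} l))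
          * pmf (\<pi> (s i)) (x (s i))"
    unfolding sum_distrib_left sum_distrib_right
    by (intro arg_cong2[where f = "(+)"] sum.cong refl) (simp_all only: old new mult_ac)
  finally have L: "?L = \<dots>" .
  have step: "field_pmf \<pi> \<pi>t \<pi>h \<beta> s i x = field_pmf \<pi> \<pi>t \<pi>h \<beta> s (Suc m) x * pmf (\<pi> (s i)) (x (s i))
       + dev_factor (\<pi>t (s i)) (x (s i)) *
         (\<Sum>j\<in>{1..Suc m}. (\<Prod>k\<in>{1..Suc m} - {j}. pmf (\<pi>h (s k)) (x (s k)))
            * (\<beta> (s i) (s j) * dev_factor (\<pi>t (s j)) (x (s j))))"
    by (simp only: i_def field_pmf.simps Let_def diff_Suc_1)
  show ?case
    unfolding i_def[symmetric] step IH p L by (simp only: distrib_left distrib_right mult_ac add_ac)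
qed

section \<open>Centered mixed moments and covariances of the field\<close>

lemma sum_site_factor:
  assumes "finite A" "set_pmf (\<pi> (s l)) \<subseteq> A" "set_pmf (\<pi>t (s l)) \<subseteq> A"
  shows "(\<Sum>y\<in>A. site_factor \<pi> \<pi>t s J l y) = (if l \<in> J then 0 else 1)"
  using sum_dev_factor[OF assms(1,3)] sum_pmf_eq_1[OF assms(1,2)]
  by (simp add: site_factor_def)

lemma sum_site_factor_centered:
  assumes "finite A" "set_pmf (\<pi> (s l)) \<subseteq> A" "set_pmf (\<pi>t (s l)) \<subseteq> A"
    and "pmf_variance (\<pi>t (s l)) > 0"
  shows "(\<Sum>y\<in>A. site_factor \<pi> \<pi>t s J l y * (y - pmf_mean (\<pi> (s l)))) = (if l \<in> J then 1 else 0)"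
  using sum_dev_factor_centered[OF assms(1,3,4)] sum_pmf_centered[OF assms(1,2)]
  by (simp add: site_factor_def)

text \<open>An orthogonality relation. The sum splits into one factor per position: a deviation
  factor pairs to 1 with a centered variable and to 0 with the constant 1, an ordinary pmf the other
  way round. Hence a position contributes 1 exactly when it lies in both of \<open>J\<close>,
  \<open>K\<close> or in neither.\<close>

lemma sum_site_factor_centered_prod:
  assumes s: "inj_on s {1..n}" and K: "K \<subseteq> {1..n}"
    and "\<And>k. k \<in> {1..n} \<Longrightarrow> finite (E (s k))"
    and "\<And>k. k \<in> {1..n} \<Longrightarrow> set_pmf (\<pi> (s k)) \<subseteq> E (s k)"
    and "\<And>k. k \<in> {1..n} \<Longrightarrow> set_pmf (\<pi>t (s k)) \<subseteq> E (s k)"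
    and "\<And>k. k \<in> {1..n} \<Longrightarrow> pmf_variance (\<pi>t (s k)) > 0"
    and J: "J \<subseteq> {1..n}"
  shows "(\<Sum>x\<in>PiE (s ` {1..n}) E. (\<Prod>l\<in>{1..n}. site_factor \<pi> \<pi>t s J l (x (s l)))
            * (\<Prod>l\<in>K. x (s l) - pmf_mean (\<pi> (s l))))
       = of_bool (J = K)" (is "?L = _")
proof -
  \<comment> \<open>Padding with 1 outside \<open>K\<close> lets the weight run over all
    positions.\<close>
  let ?w = "\<lambda>l y. if l \<in> K then y - pmf_mean (\<pi> (s l)) else 1"
  have "?L = (\<Sum>x\<in>PiE (s ` {1..n}) E. \<Prod>l\<in>{1..n}. site_factor \<pi> \<pi>t s J l (x (s l)) * ?w l (x (s l)))"
    using K by (simp add: prod.distrib prod.inter_restrict[symmetric] Int_absorb1)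
  also have "\<dots> = (\<Prod>l\<in>{1..n}. \<Sum>y\<in>E (s l). site_factor \<pi> \<pi>t s J l y * ?w l y)"
    using assms by (intro sum_PiE_prod_reindex) auto
  also have "\<dots> = (\<Prod>l\<in>{1..n}. of_bool (l \<in> J \<longleftrightarrow> l \<in> K))"
    using assms by (intro prod.cong refl)
      (auto simp: sum_site_factor_centered sum_site_factor)
  also have "\<dots> = of_bool (J = K)"
  proof (cases "J = K")
    case False
    then obtain l where "l \<in> {1..n}" "\<not> (l \<in> J \<longleftrightarrow> l \<in> K)" using J K by blast
    then have "\<exists>l\<in>{1..n}. of_bool (l \<in> J \<longleftrightarrow> l \<in> K) = (0::real)" by auto
    then show ?thesis using False by (subst prod_zero) auto
  qed simp
  finally show ?thesis .
qed

text \<open>Orthogonality applied termwise to the expansion. The cases of interest are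
  \<open>K\<close> empty, a singleton or a pair, which give total mass, means and
  covariances.\<close>

lemma sum_field_pmf_centered_prod:
  assumes s: "inj_on s {1..n}" and K: "K \<subseteq> {1..n}"
    and "\<And>k. k \<in> {1..n} \<Longrightarrow> finite (E (s k))"
    and "\<And>k. k \<in> {1..n} \<Longrightarrow> set_pmf (\<pi> (s k)) \<subseteq> E (s k)"
    and "\<And>k. k \<in> {1..n} \<Longrightarrow> set_pmf (\<pi>t (s k)) \<subseteq> E (s k)"
    and "\<And>k. k \<in> {1..n} \<Longrightarrow> pmf_variance (\<pi>t (s k)) > 0"
    and \<pi>h: "\<And>k. k \<in> {1..n} \<Longrightarrow> \<pi>h (s k) = \<pi> (s k)"
  shows "(\<Sum>x\<in>PiE (s ` {1..n}) E. field_pmf \<pi> \<pi>t \<pi>h \<beta> s n x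
            * (\<Prod>l\<in>K. x (s l) - pmf_mean (\<pi> (s l))))
       = of_bool (K = {})
         + (\<Sum>k\<in>{1..n}. \<Sum>j\<in>{1..<k}. \<beta> (s k) (s j) * of_bool ({j, k} = K))" (is "?L = _")
proof -
  let ?C = "PiE (s ` {1..n}) E"
  let ?F = "\<lambda>J x. \<Prod>l\<in>{1..n}. site_factor \<pi> \<pi>t s J l (x (s l))"
  let ?W = "\<lambda>x. \<Prod>l\<in>K. x (s l) - pmf_mean (\<pi> (s l))"
  note S = sum_site_factor_centered_prod[where \<pi> = \<pi> and \<pi>t = \<pi>t and s = s and E = E, OF assms(1-6)]
  have "?L = (\<Sum>x\<in>?C. ?F {} x * ?W x
      + (\<Sum>k\<in>{1..n}. \<Sum>j\<in>{1..<k}. \<beta> (s k) (s j) * (?F {j, k} x * ?W x)))"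
    by (subst field_pmf_expansion[where \<pi> = \<pi> and \<pi>h = \<pi>h and s = s and n = n, OF \<pi>h])
       (simp_all add: distrib_right sum_distrib_right mult.assoc)
  also have "\<dots> = (\<Sum>x\<in>?C. ?F {} x * ?W x)
      + (\<Sum>x\<in>?C. \<Sum>k\<in>{1..n}. \<Sum>j\<in>{1..<k}. \<beta> (s k) (s j) * (?F {j, k} x * ?W x))"
    by (rule sum.distrib)
  also have "(\<Sum>x\<in>?C. \<Sum>k\<in>{1..n}. \<Sum>j\<in>{1..<k}. \<beta> (s k) (s j) * (?F {j, k} x * ?W x))
      = (\<Sum>k\<in>{1..n}. \<Sum>j\<in>{1..<k}. \<beta> (s k) (s j) * (\<Sum>x\<in>?C. ?F {j, k} x * ?W x))"
    by (subst sum.swap, intro sum.cong refl, subst sum.swap) (simp add: sum_distrib_left)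
  also have "\<dots> = (\<Sum>k\<in>{1..n}. \<Sum>j\<in>{1..<k}. \<beta> (s k) (s j) * of_bool ({j, k} = K))"
    by (intro sum.cong refl arg_cong2[where f = "(*)"] S) auto
  also have "(\<Sum>x\<in>?C. ?F {} x * ?W x) = of_bool (K = {})"
    using S[of "{}"] by auto
  finally show ?thesis .
qed

text \<open>Each unordered pair is enumerated once, with the smaller element first, so a crossed
  match of the two doubletons would contradict the ordering.\<close>

lemma sum_ordered_pairs_of_bool:
  fixes b :: "nat \<Rightarrow> nat \<Rightarrow> real"
  assumes "j < k" "j \<in> {1..n}" "k \<in> {1..n}"
  shows "(\<Sum>k'\<in>{1..n}. \<Sum>j'\<in>{1..<k'}. b k' j' * of_bool ({j', k'} = {j, k})) = b k j"
proof -
  have "(\<Sum>k'\<in>{1..n}. \<Sum>j'\<in>{1..<k'}. b k' j' * of_bool ({j', k'} = {j, k}))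
      = (\<Sum>k'\<in>{1..n}. \<Sum>j'\<in>{1..<k'}. if k' = k then (if j' = j then b k j else 0) else 0)"
    using assms(1) by (intro sum.cong refl) (auto simp: doubleton_eq_iff)
  also have "\<dots> = (\<Sum>k'\<in>{1..n}. if k' = k then (\<Sum>j'\<in>{1..<k}. if j' = j then b k j else 0) else 0)"
    by (intro sum.cong refl) auto
  also have "\<dots> = b k j"
    using assms by (simp add: sum.delta)
  finally show ?thesis .
qed

lemma covariance_field_pmf:
  fixes s :: "nat \<Rightarrow> 's" and X :: "'s \<Rightarrow> 'a \<Rightarrow> real"
  assumes s: "inj_on s {1..n}"
    and "\<And>k. k \<in> {1..n} \<Longrightarrow> finite (E (s k))"
    and "\<And>k. k \<in> {1..n} \<Longrightarrow> set_pmf (\<pi> (s k)) \<subseteq> E (s k)"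
    and "\<And>k. k \<in> {1..n} \<Longrightarrow> set_pmf (\<pi>t (s k)) \<subseteq> E (s k)"
    and "\<And>k. k \<in> {1..n} \<Longrightarrow> pmf_variance (\<pi>t (s k)) > 0"
    and "\<And>k. k \<in> {1..n} \<Longrightarrow> \<pi>h (s k) = \<pi> (s k)"
    and nonneg: "\<And>x. x \<in> PiE (s ` {1..n}) E \<Longrightarrow> 0 \<le> field_pmf \<pi> \<pi>t \<pi>h \<beta> s n x"
    and Z: "distributed M (count_space (PiE (s ` {1..n}) E))
           (\<lambda>\<omega>. \<lambda>t\<in>s ` {1..n}. X t \<omega>) (\<lambda>x. ennreal (field_pmf \<pi> \<pi>t \<pi>h \<beta> s n x))"
    and jk: "j < k" "j \<in> {1..n}" "k \<in> {1..n}"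
  shows "covariance M (X (s k)) (X (s j)) = \<beta> (s k) (s j)"
proof -
  let ?C = "PiE (s ` {1..n}) E" and ?f = "field_pmf \<pi> \<pi>t \<pi>h \<beta> s n"
  let ?m = "\<lambda>l. pmf_mean (\<pi> (s l))"
  have C: "finite ?C" using assms(2) by (intro finite_PiE) auto
  note S = sum_field_pmf_centered_prod[where \<pi> = \<pi> and \<pi>t = \<pi>t and \<pi>h = \<pi>h and s = s and E = E
        and \<beta> = \<beta>, OF s _ assms(2-6)]
  note I = integral_distributed_count_space[OF C Z nonneg]
  have total: "(\<Sum>x\<in>?C. ?f x) = 1"
    using S[of "{}"] by simp
  have mean: "integral\<^sup>L M (X (s l)) = ?m l" if l: "l \<in> {1..n}" for l
  proof -
    \<comment> \<open>Since \<open>j' < k'\<close>, no pair is a singleton; the pair terms therefore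
      leave the means of \<open>\<pi>\<close> unchanged.\<close>
    have "(\<Sum>k'\<in>{1..n}. \<Sum>j'\<in>{1..<k'}. \<beta> (s k') (s j') * of_bool ({j', k'} = {l})) = 0"
      by (intro sum.neutral ballI) auto
    then have "(\<Sum>x\<in>?C. ?f x * (x (s l) - ?m l)) = 0"
      using S[of "{l}"] l by (simp del: of_bool_eq_0_iff sum_mult_of_bool_eq)
    then have "(\<Sum>x\<in>?C. ?f x * x (s l)) = ?m l"
      using total by (simp add: right_diff_distrib sum_subtractf flip: sum_distrib_right)
    then show ?thesis
      using I[of "\<lambda>x. x (s l)"] l by simp
  qed
  have "covariance M (X (s k)) (X (s j)) = (\<integral>\<omega>. (X (s k) \<omega> - ?m k) * (X (s j) \<omega> - ?m j) \<partial>M)"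
    using jk by (simp add: covariance_def mean)
  also have "\<dots> = (\<Sum>x\<in>?C. ?f x * ((x (s k) - ?m k) * (x (s j) - ?m j)))"
    using I[of "\<lambda>x. (x (s k) - ?m k) * (x (s j) - ?m j)"] jk by simp
  also have "\<dots> = (\<Sum>x\<in>?C. ?f x * (\<Prod>l\<in>{j, k}. x (s l) - ?m l))"
    using jk by (simp add: mult_ac)
  also have "\<dots> = \<beta> (s k) (s j)"
    using S[of "{j, k}"] jk sum_ordered_pairs_of_bool[OF jk, of "\<lambda>k j. \<beta> (s k) (s j)"] by simp
  finally show ?thesis .
qed

section \<open>Splitting off an uncorrelated site\<close>

lemma field_pmf_factorization:
  assumes s: "inj_on s {1..n}" and i: "i \<in> {1..n}"
    and \<pi>h: "\<And>k. k \<in> {1..n} \<Longrightarrow> \<pi>h (s k) = \<pi> (s k)"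
    and \<beta>: "\<And>j k. j \<in> {1..n} \<Longrightarrow> k \<in> {1..n} \<Longrightarrow> j < k \<Longrightarrow> i = j \<or> i = k \<Longrightarrow> \<beta> (s k) (s j) = 0"
  shows "\<exists>h. \<forall>x. field_pmf \<pi> \<pi>t \<pi>h \<beta> s n x
      = pmf (\<pi> (s i)) (x (s i)) * h (restrict x (s ` ({1..n} - {i})))"
proof (intro exI allI)
  let ?T = "s ` ({1..n} - {i})"
  let ?G = "\<lambda>J x. \<Prod>l\<in>{1..n} - {i}. site_factor \<pi> \<pi>t s J l (x (s l))"
  \<comment> \<open>The cofactor is the expansion with the factor of position \<open>i\<close>
    deleted from every product.\<close>
  let ?h = "\<lambda>x. ?G {} x + (\<Sum>k\<in>{1..n}. \<Sum>j\<in>{1..<k}. \<beta> (s k) (s j) * ?G {j, k} x)"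
  fix x
  \<comment> \<open>\<open>?G\<close> reads only sites in \<open>?T\<close>, so restricting the
    configuration changes nothing.\<close>
  have G: "?G J (restrict x ?T) = ?G J x" for J
    by (intro prod.cong) auto
  have F: "(\<Prod>l\<in>{1..n}. site_factor \<pi> \<pi>t s J l (x (s l))) = pmf (\<pi> (s i)) (x (s i)) * ?G J x"
    if "i \<notin> J" for J
    using i that by (subst prod.remove[of _ i]) (auto simp: site_factor_def)
  \<comment> \<open>A pair containing \<open>i\<close> has coefficient 0, so both sides vanish
    although \<open>\<pi> (s i)\<close> is not a factor of its product.\<close>
  have pair: "\<beta> (s k) (s j) * (\<Prod>l\<in>{1..n}. site_factor \<pi> \<pi>t s {j, k} l (x (s l)))
      = pmf (\<pi> (s i)) (x (s i)) * (\<beta> (s k) (s j) * ?G {j, k} x)"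
    if "k \<in> {1..n}" "j \<in> {1..<k}" for j k
  proof (cases "i \<in> {j, k}")
    case True
    then show ?thesis using \<beta>[of j k] that by auto
  next
    case False
    then show ?thesis by (simp only: F[OF False] mult_ac)
  qed
  have e: "field_pmf \<pi> \<pi>t \<pi>h \<beta> s n x
       = (\<Prod>l\<in>{1..n}. site_factor \<pi> \<pi>t s {} l (x (s l)))
         + (\<Sum>k\<in>{1..n}. \<Sum>j\<in>{1..<k}. \<beta> (s k) (s j)
              * (\<Prod>l\<in>{1..n}. site_factor \<pi> \<pi>t s {j, k} l (x (s l))))"
    using \<pi>h by (rule field_pmf_expansion)
  show "field_pmf \<pi> \<pi>t \<pi>h \<beta> s n x = pmf (\<pi> (s i)) (x (s i)) * ?h (restrict x ?T)"
    unfolding G e distrib_left sum_distrib_left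
    by (intro arg_cong2[where f = "(+)"] sum.cong refl F pair) auto
qed

theorem corollary5p3:
  fixes S :: "'s set" and nb :: "'s \<Rightarrow> 's set"
    and s :: "nat \<Rightarrow> 's" and n :: nat
    and E :: "'s \<Rightarrow> real set"
    and \<pi> \<pi>t \<pi>h :: "'s \<Rightarrow> real pmf"
    and \<beta> :: "'s \<Rightarrow> 's \<Rightarrow> real"
    and M :: "'a measure" and X :: "'s \<Rightarrow> 'a \<Rightarrow> real"
    and i :: nat
  assumes "connected_site_space S nb"
    and "n \<ge> 2"
    and "\<And>k. k \<in> {1..n} \<Longrightarrow> s k \<in> S"
    and "\<And>j k. j \<in> {1..n} \<Longrightarrow> k \<in> {1..n} \<Longrightarrow> j \<noteq> k \<Longrightarrow> s j \<in> nb (s k)"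
    and "\<And>k. k \<in> {1..n} \<Longrightarrow> finite (E (s k))"
    and "\<And>k. k \<in> {1..n} \<Longrightarrow> set_pmf (\<pi> (s k)) = E (s k)"
    and "\<And>k. k \<in> {1..n} \<Longrightarrow> set_pmf (\<pi>t (s k)) \<subseteq> E (s k)"
    and "\<And>k. k \<in> {1..n} \<Longrightarrow> set_pmf (\<pi>h (s k)) \<subseteq> E (s k)"
    and "\<And>k. k \<in> {1..n} \<Longrightarrow> pmf_variance (\<pi>t (s k)) > 0"
    and "\<And>j k. j \<in> {1..n} \<Longrightarrow> k \<in> {1..n} \<Longrightarrow> j \<noteq> k \<Longrightarrow> \<beta> (s j) (s k) = \<beta> (s k) (s j)"
    and "field_regular E \<pi> \<pi>t \<pi>h \<beta> s n"
    and "prob_space M"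
    and "distributed M (count_space (PiE (s ` {1..n}) E))
           (\<lambda>\<omega>. \<lambda>t\<in>s ` {1..n}. X t \<omega>) (\<lambda>x. ennreal (field_pmf \<pi> \<pi>t \<pi>h \<beta> s n x))"
    and "\<And>k. k \<in> {1..n} \<Longrightarrow> \<pi>h (s k) = \<pi> (s k)"
    and "i \<in> {1..n}"
    and "\<And>j. j \<in> {1..n} \<Longrightarrow> j \<noteq> i \<Longrightarrow> uncorrelated M (X (s i)) (X (s j))"
  shows "indep_rv M
           borel (X (s i))
           (PiM (s ` ({1..n} - {i})) (\<lambda>_. borel))
           (\<lambda>\<omega>. \<lambda>t\<in>s ` ({1..n} - {i}). X t \<omega>)"
proof -
  let ?f = "field_pmf \<pi> \<pi>t \<pi>h \<beta> s n"
  have irrefl: "t \<notin> nb t" if "t \<in> S" for t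
    using that assms(1) by (auto simp: connected_site_space_def site_space_def)
  \<comment> \<open>If two positions carried the same site, that site would be its own
    neighbor.\<close>
  have inj: "inj_on s {1..n}"
  proof (rule inj_onI, rule ccontr)
    fix j k assume jk: "j \<in> {1..n}" "k \<in> {1..n}" "s j = s k" "j \<noteq> k"
    then have "s k \<in> nb (s k)" using assms(4)[of j k] by simp
    then show False using irrefl assms(3) jk by blast
  qed
  have nonneg: "0 \<le> ?f x" if "x \<in> PiE (s ` {1..n}) E" for x
  proof -
    \<comment> \<open>Regularity is taken at the identity permutation and the full length
      \<open>n\<close>.\<close>
    have "is_joint_pmf ((s \<circ> id) ` {1..n}) E (field_pmf \<pi> \<pi>t \<pi>h \<beta> (s \<circ> id) n)"
      using assms(11) assms(2) permutes_id[of "{1..n}"] unfolding field_regular_def by fastforce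
    then show ?thesis using that by (simp add: is_joint_pmf_def)
  qed
  have cov: "covariance M (X (s k)) (X (s j)) = \<beta> (s k) (s j)"
    if "j < k" "j \<in> {1..n}" "k \<in> {1..n}" for j k
    using that by (intro covariance_field_pmf[where n = n, OF inj assms(5) _ assms(7,9,14) nonneg assms(13)])
      (use assms(6) in auto)
  have sym: "covariance M Y Z = covariance M Z Y" for Y Z
    by (simp add: covariance_def mult.commute)
  \<comment> \<open>\<open>cov\<close> puts the larger position first, while uncorrelatedness is
    given with \<open>s i\<close> first; \<open>sym\<close> bridges the case where \<open>i\<close>
    is the smaller position.\<close>
  have \<beta>: "\<beta> (s k) (s j) = 0"
    if "j \<in> {1..n}" "k \<in> {1..n}" "j < k" "i = j \<or> i = k" for j k
    using that cov[of j k] sym[of "X (s k)" "X (s j)"] assms(16)[of j] assms(16)[of k]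
    unfolding uncorrelated_def by auto
  obtain h where h: "\<And>x. ?f x = pmf (\<pi> (s i)) (x (s i)) * h (restrict x (s ` ({1..n} - {i})))"
    using field_pmf_factorization[where \<beta> = \<beta> and \<pi> = \<pi> and \<pi>h = \<pi>h and \<pi>t = \<pi>t and s = s,
        OF inj assms(15,14) \<beta>] by blast
  have ins: "s ` {1..n} = insert (s i) (s ` ({1..n} - {i}))"
    using assms(15) by blast
  show ?thesis
  proof (rule indep_rv_product_density[OF assms(12)])
    show "s i \<notin> s ` ({1..n} - {i})"
      using inj assms(15) by (auto dest: inj_onD)
    show "\<And>t. t \<in> insert (s i) (s ` ({1..n} - {i})) \<Longrightarrow> finite (E t)"
      using assms(5) unfolding ins[symmetric] by auto
    show "distributed M (count_space (PiE (insert (s i) (s ` ({1..n} - {i}))) E))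
        (\<lambda>\<omega>. \<lambda>t\<in>insert (s i) (s ` ({1..n} - {i})). X t \<omega>) (\<lambda>x. ennreal (?f x))"
      using assms(13) unfolding ins[symmetric] .
    show "\<And>x. x \<in> PiE (insert (s i) (s ` ({1..n} - {i}))) E \<Longrightarrow> 0 \<le> ?f x"
      using nonneg unfolding ins[symmetric] .
  qed (use h in auto)
qed

end
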